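(* Let $n,m,p\in\mathbb{Z}_{>0}$, $A\in\mathbb{R}^{n\times n}$, $B\in\mathbb{R}^{n\times m}$ with $(A,B)$ stabilizable, and let $C\in\mathbb{R}^{p\times n}$, $D\in\mathbb{R}^{p\times m}$ be such that $Q:=C^\top C\succ0$, $R:=D^\top D\succ 0$ and $C^\top D=0$. Fix any $\gamma\in[0,1]$. Let $P_\gamma=P_\gamma^\top\succ0$ be the (unique symmetric positive definite) solution to $$P_\gamma=\gamma A^\top P_\gamma A-\gamma^2A^\top P_\gamma B(R+\gamma B^\top P_\gamma B)^{-1}B^\top P_\gamma A+Q,$$ and let $K_\gamma:=-\gamma(R+\gamma B^\top P_\gamma B)^{-1}B^\top P_\gamma A$. Suppose there exist symmetric matrices $\bar L_\gamma,\bar Z_\gamma\in\mathbb{R}^{n\times n}$ and matrices $\bar S_\gamma\in\mathbb{R}^{n\times n}$, $\bar T_\gamma\in\mathbb{R}^{m\times n}$ such that $$\begin{bmatrix}\bar S_\gamma+\bar S_\gamma^\top-\bar L_\gamma & (\bullet)^\top\\ \bar T_\gamma-K_\gamma\bar S_\gamma & \mathbf{1}\end{bmatrix}\succeq0,\qquad \begin{bmatrix}\bar S_\gamma+\bar S_\gamma^\top-\bar Z_\gamma & (\bullet)^\top\\ A\bar S_\gamma+B\bar T_\gamma & \bar Z_\gamma\end{bmatrix}\succ0.$$ Then $\bar K_\gamma=\bar T_\gamma\bar S_\gamma^{-1}$ satisfies $\bar K_\gamma\in\mathcal{K}_1$, i.e., $\rho(A+B\bar K_\gamma)<1$, and $$(\bar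 K_\gamma-K_\gamma)^\top(\bar K_\gamma-K_\gamma)\preceq\bar L_\gamma^{-1}.$$
   Context: $\rho(M)$ denotes the spectral radius of a square matrix $M$; $\succ0$ (resp. $\succeq 0$) means symmetric positive definite (resp. semidefinite), and $M\preceq N$ means $N-M\succeq0$; $\mathbf{1}$ is the identity matrix of appropriate dimension; $(\bullet)^\top$ in a block matrix denotes the block making the matrix symmetric. $(A,B)$ stabilizable means there is $K\in\mathbb{R}^{m\times n}$ with $\rho(A+BK)<1$. $\mathcal{K}_1:=\{K\in\mathbb{R}^{m\times n}:\rho(A+BK)<1\}$. Under the stated assumptions the discounted Riccati equation in the claim has a unique symmetric positive definite solution $P_\gamma$ (known fact), and $u=K_\gamma x$ is the optimal feedback for the system $x_{k+1}=Ax_k+Bu_k$ with cost $\sum_{k\ge0}\gamma^k(x_k^\top Qx_k+u_k^\top Ru_k)$.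
   Formalization: The final inequality is stated under the added condition that L̄_γ is positive definite, since for merely symmetric L̄_γ it can fail (e.g. L̄_γ = −1 in dimension one) or L̄_γ^{-1} may not exist; invertibility of S̄_γ is proved as part of the conclusion. *)

theory Defs
  imports
    "Jordan_Normal_Form.Gauss_Jordan_Elimination"
    "Jordan_Normal_Form.Spectral_Radius"
begin

definition pos_def_mat :: "real mat \<Rightarrow> bool" where
  "pos_def_mat M \<longleftrightarrow> square_mat M \<and> M\<^sup>T = M \<and>
     (\<forall>x \<in> carrier_vec (dim_row M). x \<noteq> 0\<^sub>v (dim_row M) \<longrightarrow> x \<bullet> (M *\<^sub>v x) > 0)"

definition pos_semidef_mat :: "real mat \<Rightarrow> bool" where
  "pos_semidef_mat M \<longleftrightarrow> square_mat M \<and> M\<^sup>T = M \<and>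
     (\<forall>x \<in> carrier_vec (dim_row M). x \<bullet> (M *\<^sub>v x) \<ge> 0)"

definition loewner_le :: "real mat \<Rightarrow> real mat \<Rightarrow> bool" (infix "\<preceq>\<^sub>L" 50) where
  "M \<preceq>\<^sub>L N \<longleftrightarrow> pos_semidef_mat (N - M)"

text \<open>The eigenvalues of a real matrix are taken over the complex numbers.\<close>

definition real_spectral_radius :: "real mat \<Rightarrow> real" where
  "real_spectral_radius M = spectral_radius (map_mat complex_of_real M)"

text \<open>Unspecified if the argument is not invertible.\<close>

definition mat_inv :: "real mat \<Rightarrow> real mat" where
  "mat_inv M = the (mat_inverse M)"

lemma mat_inv:
  assumes M: "M \<in> carrier_mat n n" and "invertible_mat M"
  shows "mat_inv M \<in> carrier_mat n n" "M * mat_inv M = 1\<^sub>m n" "mat_inv M * M = 1\<^sub>m n"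
proof -
  from assms obtain N where N: "M * N = 1\<^sub>m n" "N * M = 1\<^sub>m (dim_row N)"
    unfolding invertible_mat_def inverts_mat_def by auto
  have "dim_col N = n" using arg_cong[OF N(1), of dim_col] by simp
  moreover have "dim_row N = n" using arg_cong[OF N(2), of dim_col] M by simp
  ultimately have "N \<in> carrier_mat n n" by auto
  with M N have "M \<in> Units (ring_mat TYPE(real) n ())"
    unfolding Units_def ring_mat_def by auto
  with mat_inverse(1)[OF M, of "()"] obtain N' where "mat_inverse M = Some N'"
    by (cases "mat_inverse M") auto
  with mat_inverse(2)[OF M this]
  show "mat_inv M \<in> carrier_mat n n" "M * mat_inv M = 1\<^sub>m n" "mat_inv M * M = 1\<^sub>m n"
    by (auto simp: mat_inv_def)
qed

text \<open>The set \<open>\<K>\<^sub>1\<close> of the gains \<open>K\<close> with \<open>\<rho>(A + B K) < 1\<close>.\<close>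

definition stabilizing_gains :: "nat \<Rightarrow> nat \<Rightarrow> real mat \<Rightarrow> real mat \<Rightarrow> real mat set" where
  "stabilizing_gains n m A B = {K \<in> carrier_mat m n. real_spectral_radius (A + B * K) < 1}"

definition stabilizable :: "nat \<Rightarrow> nat \<Rightarrow> real mat \<Rightarrow> real mat \<Rightarrow> bool" where
  "stabilizable n m A B \<longleftrightarrow> (\<exists>K \<in> carrier_mat m n. real_spectral_radius (A + B * K) < 1)"

text \<open>The block matrix \<open>[X, Y\<^sup>T; Y, W]\<close>.\<close>

definition sym_block_mat :: "real mat \<Rightarrow> real mat \<Rightarrow> real mat \<Rightarrow> real mat" where
  "sym_block_mat X Y W = four_block_mat X Y\<^sup>T Y W"

end

theory Submission
  imports Defs
begin

text \<open>
  Only test vectors are needed for the two block inequalities. Put \<open>F = A + B Kbar\<close>, so that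
  \<open>A S + B T = F S\<close>. The vector \<open>(F\<^sup>T w, - w)\<close> cancels every term containing \<open>S\<close> in the second
  inequality and leaves \<open>w\<^sup>T Z w > (F\<^sup>T w)\<^sup>T Z (F\<^sup>T w)\<close>, a Lyapunov inequality for \<open>F\<^sup>T\<close>. With
  \<open>E = Kbar - K\<close>, the vector \<open>(S\<inverse> w, - E w)\<close> in the first inequality gives
  \<open>|E w|\<^sup>2 \<le> 2 x\<^sup>T w - x\<^sup>T L x\<close> for \<open>x = S\<inverse> w\<close>, and completing the square bounds the right-hand
  side by \<open>w\<^sup>T L\<inverse> w\<close>.
\<close>

section \<open>Invertibility criteria and quadratic forms of block matrices\<close>

lemma mult_mat_vec_zero:
  fixes M :: "'a :: semiring_0 mat"
  assumes "M \<in> carrier_mat m n"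
  shows "M *\<^sub>v 0\<^sub>v n = 0\<^sub>v m"
  using assms by (intro eq_vecI) auto

lemma invertible_mat_if_inj:
  fixes M :: "'a :: field mat"
  assumes M: "M \<in> carrier_mat n n"
    and inj: "\<And>x. x \<in> carrier_vec n \<Longrightarrow> M *\<^sub>v x = 0\<^sub>v n \<Longrightarrow> x = 0\<^sub>v n"
  shows "invertible_mat M"
proof -
  have "det M \<noteq> 0"
    using det_0_iff_vec_prod_zero[OF M] inj by blast
  from det_non_zero_imp_unit[OF M this, of "()"] obtain N
    where "N \<in> carrier_mat n n" "M * N = 1\<^sub>m n" "N * M = 1\<^sub>m n"
    unfolding Units_def ring_mat_def by auto
  then show ?thesis
    using M unfolding invertible_mat_def inverts_mat_def by auto
qed

text \<open>A kernel vector gives the form the value 0. The hypothesis is on the form rather than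
  \<open>pos_def_mat\<close> because the lemma is applied to \<open>S\<close>, which need not be
  symmetric.\<close>

lemma invertible_mat_if_form_pos:
  fixes M :: "real mat"
  assumes M: "M \<in> carrier_mat n n"
    and pos: "\<And>x. x \<in> carrier_vec n \<Longrightarrow> x \<noteq> 0\<^sub>v n \<Longrightarrow> x \<bullet> (M *\<^sub>v x) > 0"
  shows "invertible_mat M"
proof (rule invertible_mat_if_inj[OF M])
  fix x assume x: "x \<in> carrier_vec n" and 0: "M *\<^sub>v x = 0\<^sub>v n"
  have "x \<bullet> (M *\<^sub>v x) = 0" using x unfolding 0 by simp
  then show "x = 0\<^sub>v n" using pos[OF x] by force
qed

lemma form_transpose:
  fixes M :: "real mat"
  assumes "M \<in> carrier_mat n n" "x \<in> carrier_vec n"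
  shows "x \<bullet> (M\<^sup>T *\<^sub>v x) = x \<bullet> (M *\<^sub>v x)"
  using transpose_vec_mult_scalar[OF assms assms(2)] comm_scalar_prod[of x n "M\<^sup>T *\<^sub>v x"] assms
  by (metis mult_mat_vec_carrier transpose_carrier_mat)

lemma form_gram:
  fixes M :: "real mat"
  assumes M: "M \<in> carrier_mat m n" and x: "x \<in> carrier_vec n"
  shows "x \<bullet> ((M\<^sup>T * M) *\<^sub>v x) = (M *\<^sub>v x) \<bullet> (M *\<^sub>v x)"
proof -
  have Mx: "M *\<^sub>v x \<in> carrier_vec m" using M x by simp
  have "x \<bullet> ((M\<^sup>T * M) *\<^sub>v x) = x \<bullet> (M\<^sup>T *\<^sub>v (M *\<^sub>v x))"
    using M x by (simp add: assoc_mult_mat_vec[of _ n m _ n])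
  also have "\<dots> = (M\<^sup>T *\<^sub>v (M *\<^sub>v x)) \<bullet> x"
    using M x by (intro comm_scalar_prod[of _ n]) auto
  also have "\<dots> = (M *\<^sub>v x) \<bullet> (M *\<^sub>v x)"
    by (rule transpose_vec_mult_scalar[OF M x Mx])
  finally show ?thesis .
qed

lemma form_sym_sum_minus:
  fixes S W :: "real mat"
  assumes S: "S \<in> carrier_mat n n" and W: "W \<in> carrier_mat n n" and x: "x \<in> carrier_vec n"
  shows "x \<bullet> ((S + S\<^sup>T - W) *\<^sub>v x) = 2 * (x \<bullet> (S *\<^sub>v x)) - x \<bullet> (W *\<^sub>v x)"
proof -
  have "(S + S\<^sup>T - W) *\<^sub>v x = S *\<^sub>v x + S\<^sup>T *\<^sub>v x - W *\<^sub>v x"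
    using assms by (simp add: minus_mult_distrib_mat_vec[of _ n n] add_mult_distrib_mat_vec[of _ n n])
  then have "x \<bullet> ((S + S\<^sup>T - W) *\<^sub>v x) = x \<bullet> (S *\<^sub>v x) + x \<bullet> (S\<^sup>T *\<^sub>v x) - x \<bullet> (W *\<^sub>v x)"
    using assms by (simp add: scalar_prod_minus_distrib[of _ n] scalar_prod_add_distrib[of _ n])
  then show ?thesis using form_transpose[OF S x] by simp
qed

text \<open>The off-diagonal blocks are transposes of each other, so they contribute equally. The
  sign of \<open>- z\<close> makes the cross term negative, ready for the cancellations
  below.\<close>

lemma form_sym_block_mat:
  fixes X Y W :: "real mat"
  assumes X: "X \<in> carrier_mat n n" and Y: "Y \<in> carrier_mat m n" and W: "W \<in> carrier_mat m m"
    and x: "x \<in> carrier_vec n" and z: "z \<in> carrier_vec m"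
  shows "(x @\<^sub>v - z) \<bullet> (sym_block_mat X Y W *\<^sub>v (x @\<^sub>v - z))
    = x \<bullet> (X *\<^sub>v x) - 2 * (z \<bullet> (Y *\<^sub>v x)) + z \<bullet> (W *\<^sub>v z)"
proof -
  have neg: "N *\<^sub>v - z = - (N *\<^sub>v z)" if "N \<in> carrier_mat k m" for N :: "real mat" and k
    using that z by (intro eq_vecI) auto
  have YT: "Y\<^sup>T \<in> carrier_mat n m" using Y by simp
  have zc: "- z \<in> carrier_vec m" using z by simp
  have "(x @\<^sub>v - z) \<bullet> (sym_block_mat X Y W *\<^sub>v (x @\<^sub>v - z))
      = x \<bullet> (X *\<^sub>v x + Y\<^sup>T *\<^sub>v - z) + - z \<bullet> (Y *\<^sub>v x + W *\<^sub>v - z)"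
    unfolding sym_block_mat_def four_block_mat_mult_vec[OF X YT Y W x zc]
    using assms by (intro scalar_prod_append) auto
  also have "\<dots> = x \<bullet> (X *\<^sub>v x) - x \<bullet> (Y\<^sup>T *\<^sub>v z) - z \<bullet> (Y *\<^sub>v x) + z \<bullet> (W *\<^sub>v z)"
    unfolding neg[OF YT] neg[OF W]
    using assms by (simp add: scalar_prod_add_distrib[of _ n] scalar_prod_add_distrib[of _ m])
  also have "x \<bullet> (Y\<^sup>T *\<^sub>v z) = (Y\<^sup>T *\<^sub>v z) \<bullet> x"
    using assms by (intro comm_scalar_prod[of _ n]) auto
  also have "\<dots> = z \<bullet> (Y *\<^sub>v x)" by (rule transpose_vec_mult_scalar[OF Y x z])
  finally show ?thesis by simp
qed

section \<open>Spectral radius: a Lyapunov criterion and invariance under transposition\<close>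

lemma real_spectral_radius_less_one_if_lyapunov:
  assumes n: "n > 0" and G: "G \<in> carrier_mat n n" and Z: "Z \<in> carrier_mat n n"
    and pos: "\<And>w. w \<in> carrier_vec n \<Longrightarrow> w \<noteq> 0\<^sub>v n \<Longrightarrow> w \<bullet> (Z *\<^sub>v w) > 0"
    and decr: "\<And>w. w \<in> carrier_vec n \<Longrightarrow> w \<noteq> 0\<^sub>v n \<Longrightarrow>
      (G *\<^sub>v w) \<bullet> (Z *\<^sub>v (G *\<^sub>v w)) < w \<bullet> (Z *\<^sub>v w)"
  shows "real_spectral_radius G < 1"
proof -
  let ?G = "map_mat complex_of_real G"
  have GC: "?G \<in> carrier_mat n n" using G by simp
  \<comment> \<open>For \<open>n > 0\<close> the spectrum is nonempty and the spectral radius is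
    attained, so bounding the modulus of this one eigenvalue suffices.\<close>
  from spectral_radius_mem_max(1)[OF GC n] obtain l
    where l: "eigenvalue ?G l" and rad: "spectral_radius ?G = norm l"
    unfolding spectrum_def by auto
  from l obtain v where v: "v \<in> carrier_vec n" "v \<noteq> 0\<^sub>v n" and ev: "?G *\<^sub>v v = l \<cdot>\<^sub>v v"
    using GC unfolding eigenvalue_def eigenvector_def by auto
  \<comment> \<open>The Lyapunov inequality speaks of real vectors only, so the complex eigenvector
    is split as \<open>v = a + i b\<close>; the sum \<open>q a + q b\<close> replaces the Hermitian
    form of \<open>v\<close>.\<close>
  define a where "a = map_vec Re v"
  define b where "b = map_vec Im v"
  define q where "q w = w \<bullet> (Z *\<^sub>v w)" for w
  have a: "a \<in> carrier_vec n" and b: "b \<in> carrier_vec n"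
    using v by (auto simp: a_def b_def)
  have comp: "row ?G i \<bullet> v = l * v $ i" if "i < n" for i
    using arg_cong[OF ev, of "\<lambda>u. u $ i"] that GC v by simp
  \<comment> \<open>Since \<open>G\<close> is real, this and \<open>Gb\<close> are the real and
    imaginary parts of the eigenvector equation.\<close>
  have Ga: "G *\<^sub>v a = Re l \<cdot>\<^sub>v a - Im l \<cdot>\<^sub>v b"
  proof (rule eq_vecI)
    fix i assume "i < dim_vec (Re l \<cdot>\<^sub>v a - Im l \<cdot>\<^sub>v b)"
    then have i: "i < n" using b by simp
    have "(G *\<^sub>v a) $ i = Re (row ?G i \<bullet> v)"
      using i G v by (simp add: scalar_prod_def a_def)
    then show "(G *\<^sub>v a) $ i = (Re l \<cdot>\<^sub>v a - Im l \<cdot>\<^sub>v b) $ i"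
      using i v unfolding comp[OF i] by (simp add: a_def b_def)
  qed (use G a b in auto)
  have Gb: "G *\<^sub>v b = Im l \<cdot>\<^sub>v a + Re l \<cdot>\<^sub>v b"
  proof (rule eq_vecI)
    fix i assume "i < dim_vec (Im l \<cdot>\<^sub>v a + Re l \<cdot>\<^sub>v b)"
    then have i: "i < n" using b by simp
    have "(G *\<^sub>v b) $ i = Im (row ?G i \<bullet> v)"
      using i G v by (simp add: scalar_prod_def b_def)
    then show "(G *\<^sub>v b) $ i = (Im l \<cdot>\<^sub>v a + Re l \<cdot>\<^sub>v b) $ i"
      using i v unfolding comp[OF i] by (simp add: a_def b_def)
  qed (use G a b in auto)
  \<comment> \<open>With \<open>c = Re l\<close> and \<open>d = Im l\<close>, the cross terms here
    and in \<open>qplus\<close> are opposite. They cancel in \<open>sum\<close>, leaving the factor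
    \<open>c\<^sup>2 + d\<^sup>2\<close>, the squared modulus of \<open>l\<close>.\<close>
  have qminus: "q (c \<cdot>\<^sub>v a - d \<cdot>\<^sub>v b)
      = c\<^sup>2 * q a - c * d * (a \<bullet> (Z *\<^sub>v b) + b \<bullet> (Z *\<^sub>v a)) + d\<^sup>2 * q b" for c d
    unfolding q_def using a b Z
    by (simp add: mult_minus_distrib_mat_vec[of _ n n] mult_mat_vec[of _ n n]
        scalar_prod_minus_distrib[of _ n] minus_scalar_prod_distrib[of _ n]
        algebra_simps power2_eq_square)
  have qplus: "q (d \<cdot>\<^sub>v a + c \<cdot>\<^sub>v b)
      = d\<^sup>2 * q a + c * d * (a \<bullet> (Z *\<^sub>v b) + b \<bullet> (Z *\<^sub>v a)) + c\<^sup>2 * q b" for c d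
    unfolding q_def using a b Z
    by (simp add: mult_add_distrib_mat_vec[of _ n n] mult_mat_vec[of _ n n]
        scalar_prod_add_distrib[of _ n] add_scalar_prod_distrib[of _ n]
        algebra_simps power2_eq_square)
  have sum: "q (G *\<^sub>v a) + q (G *\<^sub>v b) = (norm l)\<^sup>2 * (q a + q b)"
    unfolding Ga Gb qminus qplus cmod_power2 by (simp add: algebra_simps)
  have zero: "q (0\<^sub>v n) = 0" "q (G *\<^sub>v 0\<^sub>v n) = 0"
    by (simp_all add: q_def mult_mat_vec_zero[OF G] mult_mat_vec_zero[OF Z])
  have "a \<noteq> 0\<^sub>v n \<or> b \<noteq> 0\<^sub>v n"
  proof (rule ccontr)
    assume "\<not> ?thesis"
    then have ab: "a = 0\<^sub>v n" "b = 0\<^sub>v n" by auto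
    have "v = 0\<^sub>v n"
    proof (rule eq_vecI)
      fix i assume "i < dim_vec (0\<^sub>v n :: complex vec)"
      then show "v $ i = 0\<^sub>v n $ i"
        using arg_cong[OF ab(1), of "\<lambda>u. u $ i"] arg_cong[OF ab(2), of "\<lambda>u. u $ i"] v(1)
        by (simp add: a_def b_def complex_eq_iff)
    qed (use v in auto)
    with v(2) show False by simp
  qed
  \<comment> \<open>One of \<open>a\<close> and \<open>b\<close> may vanish, for instance when the
    eigenvector is real. The weak inequalities cover that one, the strict ones the other.\<close>
  moreover have "0 \<le> q w \<and> q (G *\<^sub>v w) \<le> q w \<and> (w \<noteq> 0\<^sub>v n \<longrightarrow> 0 < q w \<and> q (G *\<^sub>v w) < q w)"
    if "w \<in> carrier_vec n" for w
    using pos[OF that] decr[OF that] zero by (cases "w = 0\<^sub>v n") (auto simp: q_def)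
  ultimately have less: "q (G *\<^sub>v a) + q (G *\<^sub>v b) < q a + q b" and qpos: "0 < q a + q b"
    using a b by (fastforce intro: add_less_le_mono add_le_less_mono add_pos_nonneg add_nonneg_pos)+
  have "(norm l)\<^sup>2 * (q a + q b) < 1 * (q a + q b)"
    using less unfolding sum by simp
  then have "(norm l)\<^sup>2 < 1\<^sup>2" using qpos mult_less_cancel_right_pos by fastforce
  then show ?thesis
    unfolding real_spectral_radius_def rad by (rule power2_less_imp_less) simp
qed

text \<open>A matrix and its transpose share their characteristic polynomial, hence their spectrum.
  This carries the Lyapunov estimate for \<open>F\<^sup>T\<close> back to \<open>F\<close>.\<close>

lemma real_spectral_radius_transpose:
  assumes "M \<in> carrier_mat n n"
  shows "real_spectral_radius M\<^sup>T = real_spectral_radius M"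
proof -
  let ?M = "map_mat complex_of_real M"
  have M: "?M \<in> carrier_mat n n" "?M\<^sup>T \<in> carrier_mat n n" using assms by auto
  have "map_mat complex_of_real M\<^sup>T = ?M\<^sup>T" by (intro eq_matI) auto
  then show ?thesis
    unfolding real_spectral_radius_def spectral_radius_def
    using spectrum_root_char_poly[OF M(1)] spectrum_root_char_poly[OF M(2)]
      char_poly_transpose_mat[OF M(1)] by simp
qed

section \<open>Consequences of the strict block inequality: positivity of \<open>Z\<close>,
  invertibility of \<open>S\<close>, stability\<close>

lemma slack_lmi_form_pos:
  assumes S: "S \<in> carrier_mat n n" and Z: "Z \<in> carrier_mat n n" and Y: "Y \<in> carrier_mat n n"
    and lmi: "pos_def_mat (sym_block_mat (S + S\<^sup>T - Z) Y Z)"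
    and x: "x \<in> carrier_vec n" and w: "w \<in> carrier_vec n" and nz: "x \<noteq> 0\<^sub>v n \<or> w \<noteq> 0\<^sub>v n"
  shows "0 < 2 * (x \<bullet> (S *\<^sub>v x)) - x \<bullet> (Z *\<^sub>v x) - 2 * (w \<bullet> (Y *\<^sub>v x)) + w \<bullet> (Z *\<^sub>v w)"
proof -
  let ?M = "sym_block_mat (S + S\<^sup>T - Z) Y Z"
  have X: "S + S\<^sup>T - Z \<in> carrier_mat n n" using S Z by auto
  have dim: "dim_row ?M = n + n" using X Z unfolding sym_block_mat_def by simp
  have "x @\<^sub>v - w \<noteq> 0\<^sub>v (n + n)"
  proof
    assume "x @\<^sub>v - w = 0\<^sub>v (n + n)"
    then have "x @\<^sub>v - w = 0\<^sub>v n @\<^sub>v 0\<^sub>v n" by auto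
    then have "x = 0\<^sub>v n" "- w = 0\<^sub>v n" using append_vec_eq[OF x, of "0\<^sub>v n"] by auto
    then show False using nz uminus_zero_vec_eq[OF w] by simp
  qed
  moreover have "x @\<^sub>v - w \<in> carrier_vec (n + n)" using x w by simp
  ultimately have "0 < (x @\<^sub>v - w) \<bullet> (?M *\<^sub>v (x @\<^sub>v - w))"
    using lmi dim unfolding pos_def_mat_def by auto
  then show ?thesis
    unfolding form_sym_block_mat[OF X Y Z x w] form_sym_sum_minus[OF S Z x] .
qed

text \<open>The test vector with upper part zero isolates the lower right block.\<close>

lemma slack_lmi_form_diag_pos:
  assumes S: "S \<in> carrier_mat n n" and Z: "Z \<in> carrier_mat n n" and Y: "Y \<in> carrier_mat n n"
    and lmi: "pos_def_mat (sym_block_mat (S + S\<^sup>T - Z) Y Z)"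
    and w: "w \<in> carrier_vec n" "w \<noteq> 0\<^sub>v n"
  shows "0 < w \<bullet> (Z *\<^sub>v w)"
  using slack_lmi_form_pos[OF S Z Y lmi zero_carrier_vec w(1)] w
  by (simp add: mult_mat_vec_zero[OF S] mult_mat_vec_zero[OF Y] mult_mat_vec_zero[OF Z])

text \<open>The test vector with lower part zero makes twice the form of \<open>S\<close> exceed
  that of \<open>Z\<close>, which is itself positive.\<close>

lemma invertible_mat_if_slack_lmi:
  assumes S: "S \<in> carrier_mat n n" and Z: "Z \<in> carrier_mat n n" and Y: "Y \<in> carrier_mat n n"
    and lmi: "pos_def_mat (sym_block_mat (S + S\<^sup>T - Z) Y Z)"
  shows "invertible_mat S"
proof (rule invertible_mat_if_form_pos[OF S])
  fix x :: "real vec" assume x: "x \<in> carrier_vec n" "x \<noteq> 0\<^sub>v n"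
  have "0 < 2 * (x \<bullet> (S *\<^sub>v x)) - x \<bullet> (Z *\<^sub>v x)"
    using slack_lmi_form_pos[OF S Z Y lmi x(1) zero_carrier_vec] x Y
    by (simp add: mult_mat_vec_zero[OF Z])
  then show "0 < x \<bullet> (S *\<^sub>v x)"
    using slack_lmi_form_diag_pos[OF S Z Y lmi x] by simp
qed

lemma real_spectral_radius_less_one_if_slack_lmi:
  assumes n: "n > 0" and F: "F \<in> carrier_mat n n" and S: "S \<in> carrier_mat n n"
    and Z: "Z \<in> carrier_mat n n"
    and lmi: "pos_def_mat (sym_block_mat (S + S\<^sup>T - Z) (F * S) Z)"
  shows "real_spectral_radius F < 1"
proof -
  have Y: "F * S \<in> carrier_mat n n" using F S by simp
  have "real_spectral_radius F\<^sup>T < 1"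
  proof (rule real_spectral_radius_less_one_if_lyapunov[OF n _ Z slack_lmi_form_diag_pos[OF S Z Y lmi]])
    fix w :: "real vec" assume w: "w \<in> carrier_vec n" "w \<noteq> 0\<^sub>v n"
    define x where "x = F\<^sup>T *\<^sub>v w"
    have x: "x \<in> carrier_vec n" using F w by (simp add: x_def)
    \<comment> \<open>Moving \<open>F\<close> across the inner product turns the cross term into the
      form of \<open>S\<close> at \<open>x\<close>, so it cancels the contribution of
      \<open>S + S\<^sup>T\<close>. A vanishing \<open>x\<close> is harmless: \<open>w\<close> keeps
      the test vector nonzero.\<close>
    have "w \<bullet> ((F * S) *\<^sub>v x) = w \<bullet> (F *\<^sub>v (S *\<^sub>v x))"
      using F S x by simp
    also have "\<dots> = x \<bullet> (S *\<^sub>v x)"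
      unfolding x_def using F S x w
      by (intro transpose_vec_mult_scalar[symmetric]) (auto simp: x_def)
    finally show "(F\<^sup>T *\<^sub>v w) \<bullet> (Z *\<^sub>v (F\<^sup>T *\<^sub>v w)) < w \<bullet> (Z *\<^sub>v w)"
      using slack_lmi_form_pos[OF S Z Y lmi x w(1)] w by (simp add: x_def)
  qed (use F in auto)
  then show ?thesis using real_spectral_radius_transpose[OF F] by simp
qed

section \<open>Inverses of positive definite matrices and the bound on the gain\<close>

lemma pos_def_mat_invertible:
  assumes "M \<in> carrier_mat n n" "pos_def_mat M"
  shows "invertible_mat M"
  using assms by (intro invertible_mat_if_form_pos) (auto simp: pos_def_mat_def)

text \<open>Transposing \<open>M * mat_inv M = 1\<close> gives a left inverse of the symmetric
  \<open>M\<close>, and a left inverse agrees with a right inverse.\<close>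

lemma mat_inv_transpose:
  assumes M: "M \<in> carrier_mat n n" and inv: "invertible_mat M" and sym: "M\<^sup>T = M"
  shows "(mat_inv M)\<^sup>T = mat_inv M"
proof -
  note N = mat_inv[OF M inv]
  have NT: "(mat_inv M)\<^sup>T \<in> carrier_mat n n" using N(1) by simp
  have left: "(mat_inv M)\<^sup>T * M = 1\<^sub>m n"
    using transpose_mult[OF M N(1)] unfolding N(2) sym by simp
  have "(mat_inv M)\<^sup>T = (mat_inv M)\<^sup>T * (M * mat_inv M)" using N NT by simp
  also have "\<dots> = ((mat_inv M)\<^sup>T * M) * mat_inv M"
    by (rule assoc_mult_mat[symmetric, OF NT M N(1)])
  finally show ?thesis unfolding left using N(1) by simp
qed

lemma form_mat_inv_ge:
  assumes L: "L \<in> carrier_mat n n" and pd: "pos_def_mat L"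
    and x: "x \<in> carrier_vec n" and w: "w \<in> carrier_vec n"
  shows "2 * (x \<bullet> w) - x \<bullet> (L *\<^sub>v x) \<le> w \<bullet> (mat_inv L *\<^sub>v w)"
proof -
  note N = mat_inv[OF L pos_def_mat_invertible[OF L pd]]
  \<comment> \<open>The maximiser over \<open>x\<close> of the left-hand side; the gap between the
    two sides is the form of \<open>L\<close> at \<open>x - y\<close>.\<close>
  define y where "y = mat_inv L *\<^sub>v w"
  have y: "y \<in> carrier_vec n" using N(1) w by (simp add: y_def)
  have Ly: "L *\<^sub>v y = w"
    unfolding y_def assoc_mult_mat_vec[OF L N(1) w, symmetric] N(2) using w by simp
  have sym: "L\<^sup>T = L" using pd by (simp add: pos_def_mat_def)
  have cross: "y \<bullet> (L *\<^sub>v x) = x \<bullet> w"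
    using transpose_vec_mult_scalar[OF L x y] comm_scalar_prod[OF w x] unfolding sym Ly by simp
  have d: "x - y \<in> carrier_vec n" using x y by simp
  have "0 \<le> (x - y) \<bullet> (L *\<^sub>v (x - y))"
  proof (cases "x - y = 0\<^sub>v n")
    case True
    then show ?thesis using L by simp
  next
    case False
    then show ?thesis using pd d L unfolding pos_def_mat_def by force
  qed
  also have "\<dots> = x \<bullet> (L *\<^sub>v x) - x \<bullet> w - (y \<bullet> (L *\<^sub>v x) - y \<bullet> w)"
    using L x y w
    by (simp add: mult_minus_distrib_mat_vec[of _ n n] Ly
        scalar_prod_minus_distrib[of _ n] minus_scalar_prod_distrib[of _ n])
  finally show ?thesis
    unfolding cross using comm_scalar_prod[OF y w] by (simp add: y_def)
qed

lemma gram_le_mat_inv_if_slack_lmi: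
  assumes E: "E \<in> carrier_mat m n" and S: "S \<in> carrier_mat n n" and inv: "invertible_mat S"
    and L: "L \<in> carrier_mat n n" and pd: "pos_def_mat L"
    and lmi: "pos_semidef_mat (sym_block_mat (S + S\<^sup>T - L) (E * S) (1\<^sub>m m))"
  shows "E\<^sup>T * E \<preceq>\<^sub>L mat_inv L"
proof -
  let ?M = "sym_block_mat (S + S\<^sup>T - L) (E * S) (1\<^sub>m m)"
  have invL: "invertible_mat L" by (rule pos_def_mat_invertible[OF L pd])
  note N = mat_inv[OF L invL] and V = mat_inv[OF S inv]
  have EE: "E\<^sup>T * E \<in> carrier_mat n n" using E by simp
  have X: "S + S\<^sup>T - L \<in> carrier_mat n n" and Y: "E * S \<in> carrier_mat m n"
    using E S L by auto
  have dim: "dim_row ?M = n + m" using L unfolding sym_block_mat_def by simp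
  \<comment> \<open>The Loewner order includes symmetry of the difference, which is settled before
    its form is bounded.\<close>
  have "L\<^sup>T = L" using pd by (simp add: pos_def_mat_def)
  then have "(mat_inv L - E\<^sup>T * E)\<^sup>T = mat_inv L - E\<^sup>T * E"
    using mat_inv_transpose[OF L invL] transpose_minus[OF N(1) EE] transpose_mult[of "E\<^sup>T" n m E n] E
    by simp
  moreover have "0 \<le> w \<bullet> ((mat_inv L - E\<^sup>T * E) *\<^sub>v w)" if w: "w \<in> carrier_vec n" for w
  proof -
    \<comment> \<open>Invertibility of \<open>S\<close> lets \<open>S x\<close> be an arbitrary
      vector \<open>w\<close>.\<close>
    define x where "x = mat_inv S *\<^sub>v w"
    have x: "x \<in> carrier_vec n" using V(1) w by (simp add: x_def)
    have Sx: "S *\<^sub>v x = w"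
      unfolding x_def assoc_mult_mat_vec[OF S V(1) w, symmetric] V(2) using w by simp
    \<comment> \<open>This \<open>z\<close> minimises the block form for fixed \<open>x\<close>, as
      in a Schur complement: the cross term and the identity block together give minus the squared
      norm of \<open>z\<close>.\<close>
    define z where "z = E *\<^sub>v w"
    have z: "z \<in> carrier_vec m" using E w by (simp add: z_def)
    have ESx: "(E * S) *\<^sub>v x = z" using E S x by (simp add: Sx z_def)
    have "x @\<^sub>v - z \<in> carrier_vec (n + m)" using x z by simp
    then have "0 \<le> (x @\<^sub>v - z) \<bullet> (?M *\<^sub>v (x @\<^sub>v - z))"
      using lmi dim unfolding pos_semidef_mat_def by simp
    also have "\<dots> = x \<bullet> ((S + S\<^sup>T - L) *\<^sub>v x) - 2 * (z \<bullet> ((E * S) *\<^sub>v x)) + z \<bullet> (1\<^sub>m m *\<^sub>v z)"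
      by (rule form_sym_block_mat[OF X Y one_carrier_mat x z])
    finally have "z \<bullet> z \<le> 2 * (x \<bullet> w) - x \<bullet> (L *\<^sub>v x)"
      unfolding ESx form_sym_sum_minus[OF S L x] Sx using z by simp
    also have "\<dots> \<le> w \<bullet> (mat_inv L *\<^sub>v w)" by (rule form_mat_inv_ge[OF L pd x w])
    finally have "w \<bullet> ((E\<^sup>T * E) *\<^sub>v w) \<le> w \<bullet> (mat_inv L *\<^sub>v w)"
      unfolding form_gram[OF E w] z_def .
    then show ?thesis
      unfolding minus_mult_distrib_mat_vec[OF N(1) EE w]
      using N(1) EE w mult_mat_vec_carrier[OF EE w] by (simp add: scalar_prod_minus_distrib[of _ n])
  qed
  ultimately show ?thesis
    using EE N(1) unfolding loewner_le_def pos_semidef_mat_def by auto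
qed

text \<open>The \<open>R\<close> term is positive and the other nonnegative. This makes the
  \<open>mat_inv\<close> in the optimal gain a genuine inverse; otherwise even its dimensions would
  be unknown.\<close>

lemma invertible_mat_regularised_gram:
  assumes R: "R \<in> carrier_mat m m" "pos_def_mat R" and B: "B \<in> carrier_mat n m"
    and P: "P \<in> carrier_mat n n" "pos_def_mat P" and g: "0 \<le> (g :: real)"
  shows "invertible_mat (R + g \<cdot>\<^sub>m (B\<^sup>T * P * B))"
proof (rule invertible_mat_if_form_pos)
  show "R + g \<cdot>\<^sub>m (B\<^sup>T * P * B) \<in> carrier_mat m m" using R B P by simp
  fix x :: "real vec" assume x: "x \<in> carrier_vec m" "x \<noteq> 0\<^sub>v m"
  define y where "y = B *\<^sub>v x"
  have y: "y \<in> carrier_vec n" using B x by (simp add: y_def)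
  have Py: "P *\<^sub>v y \<in> carrier_vec n" using P y by simp
  \<comment> \<open>Only the weak inequality is available, since \<open>B\<close> may have a kernel;
    strictness comes from \<open>R\<close>.\<close>
  have "0 \<le> y \<bullet> (P *\<^sub>v y)"
  proof (cases "y = 0\<^sub>v n")
    case True
    then show ?thesis using P by simp
  next
    case False
    then show ?thesis using P y unfolding pos_def_mat_def by force
  qed
  moreover have "x \<bullet> ((B\<^sup>T * P * B) *\<^sub>v x) = y \<bullet> (P *\<^sub>v y)"
  proof -
    have "(B\<^sup>T * P * B) *\<^sub>v x = B\<^sup>T *\<^sub>v (P *\<^sub>v y)"
      using B P x y by (simp add: y_def assoc_mult_mat_vec[of _ m n _ m] assoc_mult_mat_vec[of _ m n _ n])
    then have "x \<bullet> ((B\<^sup>T * P * B) *\<^sub>v x) = (B\<^sup>T *\<^sub>v (P *\<^sub>v y)) \<bullet> x"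
      using comm_scalar_prod[OF x(1), of "B\<^sup>T *\<^sub>v (P *\<^sub>v y)"] B Py by simp
    also have "\<dots> = (P *\<^sub>v y) \<bullet> y"
      using transpose_vec_mult_scalar[OF B x(1) Py] by (simp add: y_def)
    finally show ?thesis using comm_scalar_prod[OF y Py] by simp
  qed
  moreover have "0 < x \<bullet> (R *\<^sub>v x)" using R x unfolding pos_def_mat_def by force
  moreover have "x \<bullet> ((R + g \<cdot>\<^sub>m (B\<^sup>T * P * B)) *\<^sub>v x)
      = x \<bullet> (R *\<^sub>v x) + g * (x \<bullet> ((B\<^sup>T * P * B) *\<^sub>v x))"
  proof -
    have BPB: "B\<^sup>T * P * B \<in> carrier_mat m m" using B P by simp
    have "(g \<cdot>\<^sub>m (B\<^sup>T * P * B)) *\<^sub>v x = g \<cdot>\<^sub>v ((B\<^sup>T * P * B) *\<^sub>v x)"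
      using BPB x by (intro eq_vecI) auto
    then show ?thesis
      using R BPB x mult_mat_vec_carrier[OF BPB x(1)]
      by (simp add: add_mult_distrib_mat_vec[of _ m m] scalar_prod_add_distrib[of _ m])
  qed
  ultimately show "0 < x \<bullet> ((R + g \<cdot>\<^sub>m (B\<^sup>T * P * B)) *\<^sub>v x)"
    using g by (simp add: add_pos_nonneg)
qed

text \<open>Invertibility of \<open>S\<close> is part of the conclusion because
  \<open>mat_inv S\<close> is otherwise unspecified. Decreasing \<open>L\<close> preserves the first
  block inequality, so \<open>L\<close> can be singular or negative definite; the bound is therefore
  stated for positive definite \<open>L\<close>.\<close>

theorem theorem4:
  fixes n m p :: nat and \<gamma> :: real
    and A B C D Q R P K L Z S T Kbar :: "real mat"
  assumes "n > 0" and "m > 0" and "p > 0"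
    and "A \<in> carrier_mat n n" and "B \<in> carrier_mat n m"
    and "stabilizable n m A B"
    and "C \<in> carrier_mat p n" and "D \<in> carrier_mat p m"
    and "Q = C\<^sup>T * C" and "R = D\<^sup>T * D"
    and "pos_def_mat Q" and "pos_def_mat R"
    and "C\<^sup>T * D = 0\<^sub>m n m"
    and "0 \<le> \<gamma>" and "\<gamma> \<le> 1"
    and "P \<in> carrier_mat n n" and "pos_def_mat P"
    and "P = \<gamma> \<cdot>\<^sub>m (A\<^sup>T * P * A)
           - \<gamma>\<^sup>2 \<cdot>\<^sub>m (A\<^sup>T * P * B * mat_inv (R + \<gamma> \<cdot>\<^sub>m (B\<^sup>T * P * B)) * B\<^sup>T * P * A) + Q"
    and "K = - (\<gamma> \<cdot>\<^sub>m (mat_inv (R + \<gamma> \<cdot>\<^sub>m (B\<^sup>T * P * B)) * B\<^sup>T * P * A))"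
    and "L \<in> carrier_mat n n" and "L\<^sup>T = L"
    and "Z \<in> carrier_mat n n" and "Z\<^sup>T = Z"
    and "S \<in> carrier_mat n n" and "T \<in> carrier_mat m n"
    and "pos_semidef_mat (sym_block_mat (S + S\<^sup>T - L) (T - K * S) (1\<^sub>m m))"
    and "pos_def_mat (sym_block_mat (S + S\<^sup>T - Z) (A * S + B * T) Z)"
    and "Kbar = T * mat_inv S"
  shows "invertible_mat S
    \<and> Kbar \<in> stabilizing_gains n m A B
    \<and> (pos_def_mat L \<longrightarrow> (Kbar - K)\<^sup>T * (Kbar - K) \<preceq>\<^sub>L mat_inv L)"
proof -
  note A = assms(4) and B = assms(5) and P = assms(16,17) and L = assms(20)
    and Z = assms(22) and S = assms(24) and T = assms(25)
  let ?H = "R + \<gamma> \<cdot>\<^sub>m (B\<^sup>T * P * B)"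
  have R: "R \<in> carrier_mat m m" using assms(8,10) by simp
  have H: "?H \<in> carrier_mat m m" using R B P by simp
  have Hi: "mat_inv ?H \<in> carrier_mat m m"
    using mat_inv(1)[OF H] invertible_mat_regularised_gram[OF R assms(12) B P assms(14)] by simp
  have K: "K \<in> carrier_mat m n"
    unfolding assms(19) using Hi A B P by (intro uminus_carrier_mat smult_carrier_mat mult_carrier_mat) auto
  have inv: "invertible_mat S"
    by (rule invertible_mat_if_slack_lmi[OF S Z _ assms(27)]) (use A B S T in simp)
  note V = mat_inv[OF S inv]
  have Kb: "Kbar \<in> carrier_mat m n" using T V assms(28) by simp
  \<comment> \<open>This undoes the change of variables that makes the block inequalities linear in
    \<open>S\<close> and \<open>T\<close>: both off-diagonal blocks now factor through
    \<open>S\<close>, with left factors \<open>A + B * Kbar\<close> and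
    \<open>Kbar - K\<close>.\<close>
  have TS: "T = Kbar * S"
    using assoc_mult_mat[OF T V(1) S] V(3) T assms(28) by simp
  have F: "A + B * Kbar \<in> carrier_mat n n" using A B Kb by simp
  have "A * S + B * T = (A + B * Kbar) * S"
    unfolding TS using A B Kb S
    by (simp add: add_mult_distrib_mat[of _ n n] assoc_mult_mat[of _ n m _ n])
  then have "real_spectral_radius (A + B * Kbar) < 1"
    using real_spectral_radius_less_one_if_slack_lmi[OF assms(1) F S Z] assms(27) by simp
  moreover have "(Kbar - K)\<^sup>T * (Kbar - K) \<preceq>\<^sub>L mat_inv L" if pd: "pos_def_mat L"
  proof -
    have E: "Kbar - K \<in> carrier_mat m n" using Kb K by auto
    have "T - K * S = (Kbar - K) * S"
      unfolding TS using Kb K S by (simp add: minus_mult_distrib_mat)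
    then show ?thesis
      using gram_le_mat_inv_if_slack_lmi[OF E S inv L pd] assms(26) by simp
  qed
  ultimately show ?thesis using inv Kb unfolding stabilizing_gains_def by blast
qed

end
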